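(* Let $A\in\mathbb{R}^{m\times n}$, $b\in\mathbb{R}^m$ satisfy the genericity condition $\widetilde\sigma_n>\sigma_{n+1}$, and let $x$ be the unique TLS solution. When $L=I_n$, the expressions of $\kappa_\infty^{\mathrm{rel}}$ and $\kappa_c$ are equivalent to those of $m(A,b)$ and $c(A,b)$, respectively; that is, $$\frac{\left\|\,|\mathcal N|\,\mathrm{vec}(|A|)+|\mathcal H|\,|b|\,\right\|_\infty}{\|x\|_\infty}=\frac{\left\|\,|M+N|\begin{bmatrix}|\mathrm{vec}(A)|\\|b|\end{bmatrix}\right\|_\infty}{\|x\|_\infty}$$ (for $x\ne0$) and $$\left\|D_x^\dagger\left(|\mathcal N|\,\mathrm{vec}(|A|)+|\mathcal H|\,|b|\right)\right\|_\infty=\left\|D_x^\dagger\,|M+N|\begin{bmatrix}|\mathrm{vec}(A)|\\|b|\end{bmatrix}\right\|_\infty .$$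
   Context: Let $m>n$. The total least squares (TLS) problem for $A\in\mathbb{R}^{m\times n}$, $b\in\mathbb{R}^m$ is to minimize $\|[A,b]-[\widehat A,\widehat b]\|_F$ over $[\widehat A,\widehat b]\in\mathbb{R}^{m\times(n+1)}$ with $\widehat b$ in the range of $\widehat A$; any $x$ with $\widehat A x=\widehat b$ for a minimizer is a TLS solution. Let $\widetilde\sigma_n$ be the smallest singular value of $A$ and let $[A,b]=U\Sigma V^\top$ be an SVD with $U\in\mathbb{R}^{m\times m}$, $V\in\mathbb{R}^{(n+1)\times(n+1)}$ orthogonal and singular values $\sigma_1\ge\dots\ge\sigma_{n+1}\ge0$; $u_{n+1}$ and $v_{n+1}$ are the $(n+1)$th columns of $U$ and $V$. Under the genericity condition $\widetilde\sigma_n>\sigma_{n+1}$ the TLS solution $x$ is unique and $\begin{bmatrix}x\\-1\end{bmatrix}=-\frac1{v_{n+1,n+1}}v_{n+1}$, where $v_{n+1,n+1}$ is the last component of $v_{n+1}$ (with $v_{n+1,n+1}^2=1/(1+x^\top x)$). Put $r=b-Ax$, $P=A^\top A-\sigma_{n+1}^2I_n$, $$\mathcal N=P^{-1}\left[-x^\top\otimes\left(A^\top+\tfrac{2xr^\top}{1+x^\top x}\right)+I_n\otimes r^\top\right],\qquad \mathcal H=P^{-1}\left[A^\top+\tfrac{2xr^\top}{1+x^\top x}\right].$$ For $L\in\mathbb{R}^{k\times n}$, the mixed and componentwise condition numbers of $Lx$ have the expressions $\kappa_\infty^{\mathrm{rel}}=\| |L\mathcal N|\mathrm{vec}(|A|)+|L\mathcal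 H||b| \|_\infty/\|Lx\|_\infty$ and $\kappa_c=\|D_{Lx}^\dagger(|L\mathcal N|\mathrm{vec}(|A|)+|L\mathcal H||b|)\|_\infty$. The expressions (due to Zhou et al.) of $m(A,b)$ and $c(A,b)$ are $$m(A,b)=\frac{\left\||M+N|\begin{bmatrix}|\mathrm{vec}(A)|\\|b|\end{bmatrix}\right\|_\infty}{\|x\|_\infty},\qquad c(A,b)=\left\|D_x^\dagger|M+N|\begin{bmatrix}|\mathrm{vec}(A)|\\|b|\end{bmatrix}\right\|_\infty,$$ $$M=\begin{bmatrix}P^{-1}\otimes b^\top-x^\top\otimes(P^{-1}A^\top)-P^{-1}\otimes(Ax)^\top & P^{-1}A^\top\end{bmatrix},\qquad N=2\sigma_{n+1}P^{-1}x\,(v_{n+1}^\top\otimes u_{n+1}^\top).$$ $|\cdot|$ is the entrywise absolute value, $\otimes$ the Kronecker product $[a_{ij}B]$, $\mathrm{vec}$ stacks columns, $D_y$ is the diagonal matrix with diagonal $y$, and $\dagger$ is the Moore–Penrose inverse. *)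

theory Defs
  imports
    Complex_Main
    "Jordan_Normal_Form.Matrix"
    "Jordan_Normal_Form.Char_Poly"
    "Jordan_Normal_Form.Gauss_Jordan_Elimination"
begin

text \<open>Matrices and vectors are those of Jordan_Normal_Form, with 0-based indices: the
  (n+1)th column of a matrix is column n, and the (n+1)th singular value is at position (n, n).\<close>

section \<open>Matrix operations\<close>

abbreviation row_of :: "real vec \<Rightarrow> real mat" where
  "row_of v \<equiv> mat_of_row v"

abbreviation col_of :: "real vec \<Rightarrow> real mat" where
  "col_of v \<equiv> transpose_mat (mat_of_row v)"

definition hcat :: "real mat \<Rightarrow> real mat \<Rightarrow> real mat" where
  "hcat A B = mat (dim_row A) (dim_col A + dim_col B)
     (\<lambda>(i, j). if j < dim_col A then A $$ (i, j) else B $$ (i, j - dim_col A))"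

definition aug :: "real mat \<Rightarrow> real vec \<Rightarrow> real mat" where
  "aug A b = hcat A (col_of b)"

definition kron :: "real mat \<Rightarrow> real mat \<Rightarrow> real mat" where
  "kron A B = mat (dim_row A * dim_row B) (dim_col A * dim_col B)
     (\<lambda>(i, j). A $$ (i div dim_row B, j div dim_col B) * B $$ (i mod dim_row B, j mod dim_col B))"

text \<open>Column stacking: entry (i, j) of an m-row matrix goes to position j * m + i.\<close>

definition vectorize :: "real mat \<Rightarrow> real vec" where
  "vectorize A = vec (dim_row A * dim_col A) (\<lambda>k. A $$ (k mod dim_row A, k div dim_row A))"

abbreviation abs_mat :: "real mat \<Rightarrow> real mat" where
  "abs_mat A \<equiv> map_mat abs A"

abbreviation abs_vec :: "real vec \<Rightarrow> real vec" where
  "abs_vec v \<equiv> map_vec abs v"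

text \<open>Meaningful for vectors of positive length only.\<close>

definition inf_norm :: "real vec \<Rightarrow> real" where
  "inf_norm v = Max ((\<lambda>i. \<bar>v $ i\<bar>) ` {..<dim_vec v})"

definition frob_norm :: "real mat \<Rightarrow> real" where
  "frob_norm A = sqrt (\<Sum>i<dim_row A. \<Sum>j<dim_col A. (A $$ (i, j))\<^sup>2)"

definition diag_of :: "real vec \<Rightarrow> real mat" where
  "diag_of y = mat_diag (dim_vec y) (\<lambda>i. y $ i)"

definition is_moore_penrose :: "real mat \<Rightarrow> real mat \<Rightarrow> bool" where
  "is_moore_penrose A B \<longleftrightarrow>
     B \<in> carrier_mat (dim_col A) (dim_row A) \<and>
     A * B * A = A \<and> B * A * B = B \<and>
     transpose_mat (A * B) = A * B \<and> transpose_mat (B * A) = B * A"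

definition pinv :: "real mat \<Rightarrow> real mat" where
  "pinv A = (THE B. is_moore_penrose A B)"

text \<open>Used only where the argument is invertible.\<close>

definition minv :: "real mat \<Rightarrow> real mat" where
  "minv A = the (mat_inverse A)"

section \<open>Singular values\<close>

text \<open>The library's orthogonal_mat only asks for pairwise orthogonal nonzero columns, hence the
  separate notion here.\<close>

definition is_orthogonal_mat :: "nat \<Rightarrow> real mat \<Rightarrow> bool" where
  "is_orthogonal_mat k Q \<longleftrightarrow>
     Q \<in> carrier_mat k k \<and> transpose_mat Q * Q = 1\<^sub>m k \<and> Q * transpose_mat Q = 1\<^sub>m k"

definition is_svd :: "real mat \<Rightarrow> real mat \<Rightarrow> real mat \<Rightarrow> real mat \<Rightarrow> bool" where
  "is_svd B U S V \<longleftrightarrow>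
     is_orthogonal_mat (dim_row B) U \<and> is_orthogonal_mat (dim_col B) V \<and>
     S \<in> carrier_mat (dim_row B) (dim_col B) \<and> diagonal_mat S \<and>
     (\<forall>i < min (dim_row B) (dim_col B). 0 \<le> S $$ (i, i)) \<and>
     (\<forall>i j. i \<le> j \<longrightarrow> j < min (dim_row B) (dim_col B) \<longrightarrow> S $$ (j, j) \<le> S $$ (i, i)) \<and>
     B = U * S * transpose_mat V"

text \<open>For matrices with at least as many rows as columns, the only case used.  The lemmas below
  show that these are exactly the diagonal entries of the middle factor of any SVD.\<close>

definition singular_values :: "real mat \<Rightarrow> real set" where
  "singular_values A = {s. 0 \<le> s \<and> eigenvalue (transpose_mat A * A) (s\<^sup>2)}"

definition smallest_singular_value :: "real mat \<Rightarrow> real" where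
  "smallest_singular_value A = Min (singular_values A)"

lemma gram_diag_mult_vec:
  fixes S :: "real mat"
  assumes S: "S \<in> carrier_mat m n" "diagonal_mat S" and mn: "n \<le> m"
    and z: "z \<in> carrier_vec n" and i: "i < n"
  shows "((transpose_mat S * S) *\<^sub>v z) $ i = (S $$ (i, i))\<^sup>2 * z $ i"
proof -
  have ent: "(transpose_mat S * S) $$ (i, j) = (if j = i then (S $$ (i, i))\<^sup>2 else 0)" if j: "j < n" for j
  proof -
    have "(transpose_mat S * S) $$ (i, j) = (\<Sum>k<m. S $$ (k, i) * S $$ (k, j))"
      using S i j by (auto simp: scalar_prod_def lessThan_atLeast0 intro!: sum.cong)
    also have "\<dots> = (\<Sum>k<m. if k = i then S $$ (i, i) * S $$ (i, j) else 0)"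
      using S i j by (intro sum.cong) (auto simp: diagonal_mat_def)
    also have "\<dots> = S $$ (i, i) * S $$ (i, j)"
      using i mn by simp
    also have "\<dots> = (if j = i then (S $$ (i, i))\<^sup>2 else 0)"
      using S i j mn by (cases "j = i") (auto simp: diagonal_mat_def power2_eq_square)
    finally show ?thesis .
  qed
  have "((transpose_mat S * S) *\<^sub>v z) $ i = (\<Sum>j<n. (transpose_mat S * S) $$ (i, j) * z $ j)"
    using S z i by (auto simp: mult_mat_vec_def scalar_prod_def lessThan_atLeast0 intro!: sum.cong)
  also have "\<dots> = (\<Sum>j<n. if j = i then (S $$ (i, i))\<^sup>2 * z $ i else 0)"
    using ent by (intro sum.cong) auto
  also have "\<dots> = (S $$ (i, i))\<^sup>2 * z $ i"
    using i by simp
  finally show ?thesis .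
qed

lemma singular_values_svd:
  assumes svd: "is_svd A U S V" and A: "A \<in> carrier_mat m n" and mn: "n \<le> m"
  shows "singular_values A = {S $$ (i, i) |i. i < n}"
proof -
  have U: "U \<in> carrier_mat m m" "transpose_mat U * U = 1\<^sub>m m"
    and V: "V \<in> carrier_mat n n" "transpose_mat V * V = 1\<^sub>m n" "V * transpose_mat V = 1\<^sub>m n"
    and S: "S \<in> carrier_mat m n" "diagonal_mat S"
    and nonneg: "\<And>i. i < n \<Longrightarrow> 0 \<le> S $$ (i, i)"
    and dec: "A = U * S * transpose_mat V"
    using svd A mn by (auto simp: is_svd_def is_orthogonal_mat_def)
  let ?G = "transpose_mat S * S"
  have G: "?G \<in> carrier_mat n n" using S by auto
  have "transpose_mat A = V * transpose_mat S * transpose_mat U"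
  proof -
    have "transpose_mat A = transpose_mat (transpose_mat V) * transpose_mat (U * S)"
      unfolding dec using U S V by (intro transpose_mult) auto
    also have "transpose_mat (U * S) = transpose_mat S * transpose_mat U"
      using U S by (intro transpose_mult) auto
    finally have "transpose_mat A = V * (transpose_mat S * transpose_mat U)"
      by (simp only: transpose_transpose)
    also have "\<dots> = V * transpose_mat S * transpose_mat U"
      by (rule assoc_mult_mat[of _ n n _ m _ m, symmetric]) (use U S V in auto)
    finally show ?thesis .
  qed
  moreover have "A = U * (S * transpose_mat V)"
    unfolding dec by (rule assoc_mult_mat[of _ m m _ n _ n]) (use U S V in auto)
  ultimately have "transpose_mat A * A = (V * transpose_mat S * transpose_mat U) * (U * (S * transpose_mat V))"
    by (simp only:)
  also have "\<dots> = V * transpose_mat S * (transpose_mat U * (U * (S * transpose_mat V)))"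
    by (rule assoc_mult_mat[of _ n m _ m _ n]) (use U S V in auto)
  also have "transpose_mat U * (U * (S * transpose_mat V)) = (transpose_mat U * U) * (S * transpose_mat V)"
    by (rule assoc_mult_mat[of _ m m _ m _ n, symmetric]) (use U S V in auto)
  also have "\<dots> = S * transpose_mat V"
    unfolding U(2) by (rule left_mult_one_mat) (use S V in auto)
  also have "V * transpose_mat S * (S * transpose_mat V) = V * (transpose_mat S * (S * transpose_mat V))"
    by (rule assoc_mult_mat[of _ n n _ m _ n]) (use S V in auto)
  also have "transpose_mat S * (S * transpose_mat V) = ?G * transpose_mat V"
    by (rule assoc_mult_mat[of _ n m _ n _ n, symmetric]) (use S V in auto)
  finally have gram: "transpose_mat A * A = V * (?G * transpose_mat V)" .
  have gram_v: "(transpose_mat A * A) *\<^sub>v w = V *\<^sub>v (?G *\<^sub>v (transpose_mat V *\<^sub>v w))"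
    if "w \<in> carrier_vec n" for w
  proof -
    have "(V * (?G * transpose_mat V)) *\<^sub>v w = V *\<^sub>v ((?G * transpose_mat V) *\<^sub>v w)"
      by (rule assoc_mult_mat_vec[of _ n n _ n]) (use that V G in auto)
    also have "(?G * transpose_mat V) *\<^sub>v w = ?G *\<^sub>v (transpose_mat V *\<^sub>v w)"
      by (rule assoc_mult_mat_vec[of _ n n _ n]) (use that V G in auto)
    finally show ?thesis unfolding gram .
  qed
  have VtV: "transpose_mat V *\<^sub>v (V *\<^sub>v z) = z" if "z \<in> carrier_vec n" for z
  proof -
    have "(transpose_mat V * V) *\<^sub>v z = transpose_mat V *\<^sub>v (V *\<^sub>v z)"
      by (rule assoc_mult_mat_vec[of _ n n _ n]) (use that V in auto)
    then show ?thesis using that by (simp only: V(2) one_mult_mat_vec)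
  qed
  have VVt: "V *\<^sub>v (transpose_mat V *\<^sub>v z) = z" if "z \<in> carrier_vec n" for z
  proof -
    have "(V * transpose_mat V) *\<^sub>v z = V *\<^sub>v (transpose_mat V *\<^sub>v z)"
      by (rule assoc_mult_mat_vec[of _ n n _ n]) (use that V in auto)
    then show ?thesis using that by (simp only: V(3) one_mult_mat_vec)
  qed
  have ATA: "dim_row (transpose_mat A * A) = n" using A by simp
  show ?thesis
  proof (intro equalityI subsetI)
    fix s assume "s \<in> singular_values A"
    then obtain w where s: "0 \<le> s" and w: "w \<in> carrier_vec n" "w \<noteq> 0\<^sub>v n"
      and ev: "(transpose_mat A * A) *\<^sub>v w = s\<^sup>2 \<cdot>\<^sub>v w"
      unfolding singular_values_def eigenvalue_def eigenvector_def ATA by auto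
    define z where "z = transpose_mat V *\<^sub>v w"
    have z: "z \<in> carrier_vec n" using V w by (simp add: z_def)
    have wz: "w = V *\<^sub>v z" using VVt w by (simp add: z_def)
    have "z \<noteq> 0\<^sub>v n" using w wz V by auto
    then have "\<not> (\<forall>i<n. z $ i = 0)"
      using z by (auto simp: vec_eq_iff)
    then obtain i where i: "i < n" "z $ i \<noteq> 0" by blast
    have "V *\<^sub>v (?G *\<^sub>v z) = s\<^sup>2 \<cdot>\<^sub>v (V *\<^sub>v z)"
      using ev gram_v[OF w(1)] unfolding z_def[symmetric] wz[symmetric] by (metis (no_types))
    then have "?G *\<^sub>v z = transpose_mat V *\<^sub>v (s\<^sup>2 \<cdot>\<^sub>v (V *\<^sub>v z))"
      using VtV[of "?G *\<^sub>v z"] G z by simp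
    also have "\<dots> = s\<^sup>2 \<cdot>\<^sub>v z"
      using VtV[OF z] mult_mat_vec[of "transpose_mat V" n n "V *\<^sub>v z"] V z by simp
    finally have "(S $$ (i, i))\<^sup>2 * z $ i = s\<^sup>2 * z $ i"
      using gram_diag_mult_vec[OF S mn z i(1)] z i by simp
    then have "S $$ (i, i) = s"
      using i s nonneg[OF i(1)] by (simp add: power2_eq_iff_nonneg)
    then show "s \<in> {S $$ (i, i) |i. i < n}" using i by auto
  next
    fix s assume "s \<in> {S $$ (i, i) |i. i < n}"
    then obtain i where i: "i < n" "s = S $$ (i, i)" by auto
    let ?e = "unit_vec n i :: real vec"
    define w where "w = V *\<^sub>v ?e"
    have w: "w \<in> carrier_vec n" using V by (simp add: w_def)
    have "w \<noteq> 0\<^sub>v n"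
    proof
      assume "w = 0\<^sub>v n"
      then have "?e = transpose_mat V *\<^sub>v 0\<^sub>v n" using VtV[of ?e] by (simp add: w_def)
      also have "\<dots> = 0\<^sub>v n" using V by (intro eq_vecI) auto
      finally have "?e = 0\<^sub>v n" .
      then have "?e $ i = 0" using i by simp
      then show False using i by simp
    qed
    moreover have "?G *\<^sub>v ?e = s\<^sup>2 \<cdot>\<^sub>v ?e"
    proof (rule eq_vecI)
      fix j assume "j < dim_vec (s\<^sup>2 \<cdot>\<^sub>v ?e)"
      then have j: "j < n" by simp
      show "(?G *\<^sub>v ?e) $ j = (s\<^sup>2 \<cdot>\<^sub>v ?e) $ j"
        using gram_diag_mult_vec[OF S mn unit_vec_carrier j] i j by auto
    qed (use G in auto)
    then have "(transpose_mat A * A) *\<^sub>v w = s\<^sup>2 \<cdot>\<^sub>v w"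
      using gram_v[OF w] VtV[of ?e] mult_mat_vec[OF V(1), of ?e] by (simp add: w_def)
    ultimately show "s \<in> singular_values A"
      using w i nonneg[OF i(1)]
      unfolding singular_values_def eigenvalue_def eigenvector_def ATA by auto
  qed
qed

lemma smallest_singular_value_svd:
  assumes svd: "is_svd A U S V" and A: "A \<in> carrier_mat m n" and mn: "n \<le> m" and n: "0 < n"
  shows "smallest_singular_value A = S $$ (n - 1, n - 1)"
  unfolding smallest_singular_value_def singular_values_svd[OF svd A mn]
proof (rule Min_eqI)
  show "finite {S $$ (i, i) |i. i < n}" by simp
  show "S $$ (n - 1, n - 1) \<in> {S $$ (i, i) |i. i < n}" using n by auto
  fix s assume "s \<in> {S $$ (i, i) |i. i < n}"
  then obtain i where "i < n" "s = S $$ (i, i)" by auto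
  moreover from this have "S $$ (n - 1, n - 1) \<le> S $$ (i, i)"
    using svd A mn unfolding is_svd_def by auto
  ultimately show "S $$ (n - 1, n - 1) \<le> s" by simp
qed

section \<open>Total least squares\<close>

definition tls_feasible :: "nat \<Rightarrow> nat \<Rightarrow> real mat \<Rightarrow> real vec \<Rightarrow> bool" where
  "tls_feasible m n A' b' \<longleftrightarrow>
     A' \<in> carrier_mat m n \<and> b' \<in> carrier_vec m \<and> (\<exists>y \<in> carrier_vec n. A' *\<^sub>v y = b')"

definition tls_minimizer :: "real mat \<Rightarrow> real vec \<Rightarrow> real mat \<Rightarrow> real vec \<Rightarrow> bool" where
  "tls_minimizer A b A' b' \<longleftrightarrow>
     tls_feasible (dim_row A) (dim_col A) A' b' \<and>
     (\<forall>A'' b''. tls_feasible (dim_row A) (dim_col A) A'' b'' \<longrightarrow>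
        frob_norm (aug A b - aug A' b') \<le> frob_norm (aug A b - aug A'' b''))"

definition is_tls_solution :: "real mat \<Rightarrow> real vec \<Rightarrow> real vec \<Rightarrow> bool" where
  "is_tls_solution A b x \<longleftrightarrow>
     x \<in> carrier_vec (dim_col A) \<and> (\<exists>A' b'. tls_minimizer A b A' b' \<and> A' *\<^sub>v x = b')"

section \<open>Condition number expressions\<close>

text \<open>Here and below, s, u and v stand for the (n+1)th singular value of the augmented matrix and
  its left and right singular vectors.\<close>

definition Pmat :: "real mat \<Rightarrow> real \<Rightarrow> real mat" where
  "Pmat A s = transpose_mat A * A - s\<^sup>2 \<cdot>\<^sub>m 1\<^sub>m (dim_col A)"

definition tls_residual :: "real mat \<Rightarrow> real vec \<Rightarrow> real vec \<Rightarrow> real vec" where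
  "tls_residual A b x = b - A *\<^sub>v x"

definition Gmat :: "real mat \<Rightarrow> real vec \<Rightarrow> real vec \<Rightarrow> real mat" where
  "Gmat A b x = transpose_mat A +
     (2 / (1 + x \<bullet> x)) \<cdot>\<^sub>m (col_of x * row_of (tls_residual A b x))"

definition calN :: "real mat \<Rightarrow> real vec \<Rightarrow> real vec \<Rightarrow> real \<Rightarrow> real mat" where
  "calN A b x s = minv (Pmat A s) *
     (kron (- row_of x) (Gmat A b x) + kron (1\<^sub>m (dim_col A)) (row_of (tls_residual A b x)))"

definition calH :: "real mat \<Rightarrow> real vec \<Rightarrow> real vec \<Rightarrow> real \<Rightarrow> real mat" where
  "calH A b x s = minv (Pmat A s) * Gmat A b x"

definition kappa_rel_inf ::
  "real mat \<Rightarrow> real mat \<Rightarrow> real vec \<Rightarrow> real vec \<Rightarrow> real \<Rightarrow> real" where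
  "kappa_rel_inf L A b x s =
     inf_norm (abs_mat (L * calN A b x s) *\<^sub>v vectorize (abs_mat A) +
               abs_mat (L * calH A b x s) *\<^sub>v abs_vec b) / inf_norm (L *\<^sub>v x)"

definition kappa_c ::
  "real mat \<Rightarrow> real mat \<Rightarrow> real vec \<Rightarrow> real vec \<Rightarrow> real \<Rightarrow> real" where
  "kappa_c L A b x s =
     inf_norm (pinv (diag_of (L *\<^sub>v x)) *\<^sub>v
       (abs_mat (L * calN A b x s) *\<^sub>v vectorize (abs_mat A) +
        abs_mat (L * calH A b x s) *\<^sub>v abs_vec b))"

definition Mmat :: "real mat \<Rightarrow> real vec \<Rightarrow> real vec \<Rightarrow> real \<Rightarrow> real mat" where
  "Mmat A b x s = (let Q = minv (Pmat A s) in
     hcat (kron Q (row_of b) - kron (row_of x) (Q * transpose_mat A) - kron Q (row_of (A *\<^sub>v x)))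
          (Q * transpose_mat A))"

definition Nmat :: "real mat \<Rightarrow> real vec \<Rightarrow> real \<Rightarrow> real vec \<Rightarrow> real vec \<Rightarrow> real mat" where
  "Nmat A x s u v =
     (2 * s) \<cdot>\<^sub>m ((minv (Pmat A s) * col_of x) * kron (row_of v) (row_of u))"

definition m_cond ::
  "real mat \<Rightarrow> real vec \<Rightarrow> real vec \<Rightarrow> real \<Rightarrow> real vec \<Rightarrow> real vec \<Rightarrow> real" where
  "m_cond A b x s u v =
     inf_norm (abs_mat (Mmat A b x s + Nmat A x s u v) *\<^sub>v
       (abs_vec (vectorize A) @\<^sub>v abs_vec b)) / inf_norm x"

definition c_cond ::
  "real mat \<Rightarrow> real vec \<Rightarrow> real vec \<Rightarrow> real \<Rightarrow> real vec \<Rightarrow> real vec \<Rightarrow> real" where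
  "c_cond A b x s u v =
     inf_norm (pinv (diag_of x) *\<^sub>v (abs_mat (Mmat A b x s + Nmat A x s u v) *\<^sub>v
       (abs_vec (vectorize A) @\<^sub>v abs_vec b)))"

end

theory Submission
  imports Defs "HOL-Analysis.L2_Norm"
begin

text \<open>
  Write \<open>B = [A, b]\<close>, \<open>s\<close> for its smallest singular value, \<open>u\<close>, \<open>v\<close> for the corresponding singular
  vectors, \<open>z = (x; -1)\<close> and \<open>Q = P\<^sup>-\<^sup>1\<close> for the inverse of \<open>P = A\<^sup>T A - s\<^sup>2 I\<close>.  The two pairs of
  expressions agree because the two matrices inside the absolute values agree:
  \<open>M + N = [calN, calH]\<close>.  Multiplying \<open>|[calN, calH]|\<close> with the stacked vector
  \<open>(|vec A|; |b|)\<close> then splits into the two summands of the other expressions.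

  The matrix identity rests on two facts about \<open>v\<close>: it is normalised, and it is proportional to \<open>z\<close>,
  so that \<open>v = - c z\<close> with \<open>c\<close> its last entry.  The first gives \<open>c\<^sup>2 (1 + x \<bullet> x) = 1\<close>.  The second gives
  \<open>s u = B v = c r\<close> with the residual \<open>r = b - A x\<close>.  Hence \<open>2 s v \<otimes> u = - 2 / (1 + x \<bullet> x) z \<otimes> r\<close>,
  and \<open>N\<close> is exactly the contribution of the rank-one part \<open>2 x r\<^sup>T / (1 + x \<bullet> x)\<close> that distinguishes \<open>calN\<close> and \<open>calH\<close>
  from \<open>M\<close> (lemma \<open>Mmat_Nmat_eq_hcat\<close>).

  That a solution \<open>x\<close> satisfies \<open>v = - c z\<close> is proved from its definition by minimality
  (lemma \<open>tls_solution_singular_vector\<close>).  Subtracting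
  \<open>s u v\<^sup>T\<close> from \<open>B\<close> is a feasible correction of Frobenius norm \<open>s\<close>, so the optimal correction \<open>E\<close> has
  norm at most \<open>s\<close>.  Since \<open>(B - E) z = 0\<close>, it follows that \<open>|B z| = |E z| \<le> s |z|\<close>, and as \<open>s\<close> is the smallest
  singular value, \<open>z\<close> is an eigenvector of \<open>B\<^sup>T B\<close> for \<open>s\<^sup>2\<close>.  Genericity makes this eigenspace a line:
  an eigenvector with last entry zero would be an eigenvector of the leading block \<open>A\<^sup>T A\<close> for \<open>s\<^sup>2\<close>, and
  \<open>s\<close> would be a singular value of \<open>A\<close>.  For the same reason \<open>P\<close> is injective, hence invertible.
\<close>

section \<open>The augmented matrix\<close>

lemma aug_carrier:
  assumes "A \<in> carrier_mat m n" "b \<in> carrier_vec m"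
  shows "aug A b \<in> carrier_mat m (Suc n)"
  using assms by (auto simp: aug_def hcat_def)

lemma aug_index:
  assumes "A \<in> carrier_mat m n" "b \<in> carrier_vec m" "i < m" "j < Suc n"
  shows "aug A b $$ (i, j) = (if j < n then A $$ (i, j) else b $ i)"
proof -
  have "j - n = 0" if "\<not> j < n" using assms(4) that by simp
  then show ?thesis using assms by (auto simp: aug_def hcat_def)
qed

lemma aug_mult_vec:
  assumes A: "A \<in> carrier_mat m n" and b: "b \<in> carrier_vec m" and w: "w \<in> carrier_vec (Suc n)"
  shows "aug A b *\<^sub>v w = A *\<^sub>v vec_first w n + (w $ n) \<cdot>\<^sub>v b"
proof (rule eq_vecI)
  fix i assume "i < dim_vec (A *\<^sub>v vec_first w n + (w $ n) \<cdot>\<^sub>v b)"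
  then have i: "i < m" using b by simp
  have "(aug A b *\<^sub>v w) $ i = (\<Sum>j<Suc n. aug A b $$ (i, j) * w $ j)"
    using aug_carrier[OF A b] w i by (simp add: scalar_prod_def lessThan_atLeast0)
  also have "\<dots> = (\<Sum>j<n. A $$ (i, j) * w $ j) + b $ i * w $ n"
    using aug_index[OF A b i] by simp
  also have "(\<Sum>j<n. A $$ (i, j) * w $ j) = (A *\<^sub>v vec_first w n) $ i"
    using A i by (simp add: scalar_prod_def lessThan_atLeast0 vec_first_def)
  finally show "(aug A b *\<^sub>v w) $ i = (A *\<^sub>v vec_first w n + (w $ n) \<cdot>\<^sub>v b) $ i"
    using A b i by (simp add: mult.commute)
qed (use aug_carrier[OF A b] b in auto)

lemma vec_first_aug_transpose_mult:
  assumes A: "A \<in> carrier_mat m n" and b: "b \<in> carrier_vec m" and t: "t \<in> carrier_vec m"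
  shows "vec_first (transpose_mat (aug A b) *\<^sub>v t) n = transpose_mat A *\<^sub>v t"
proof (rule eq_vecI)
  fix j assume "j < dim_vec (transpose_mat A *\<^sub>v t)"
  then have j: "j < n" using A by simp
  show "vec_first (transpose_mat (aug A b) *\<^sub>v t) n $ j = (transpose_mat A *\<^sub>v t) $ j"
    using A t j aug_carrier[OF A b] aug_index[OF A b]
    by (auto simp: vec_first_def scalar_prod_def intro!: sum.cong)
qed (use A in auto)

lemma square_norm_eq_sum: "(w :: real vec) \<bullet> w = (\<Sum>i<dim_vec w. (w $ i)\<^sup>2)"
  by (simp add: scalar_prod_def lessThan_atLeast0 power2_eq_square)

lemma square_norm_mult_vec:
  assumes "(B :: real mat) \<in> carrier_mat m k" "w \<in> carrier_vec k"
  shows "(B *\<^sub>v w) \<bullet> (B *\<^sub>v w) = w \<bullet> (transpose_mat B *\<^sub>v (B *\<^sub>v w))"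
proof -
  have "(transpose_mat B *\<^sub>v (B *\<^sub>v w)) \<bullet> w = (B *\<^sub>v w) \<bullet> (B *\<^sub>v w)"
    by (rule transpose_vec_mult_scalar[of _ m k]) (use assms in auto)
  then show ?thesis
    by (subst comm_scalar_prod[of _ k]) (use assms in auto)
qed

section \<open>The smallest singular value of a matrix with a given decomposition\<close>

lemma orthogonal_mat_mult_vec:
  assumes "is_orthogonal_mat k Q" "z \<in> carrier_vec k"
  shows "transpose_mat Q *\<^sub>v (Q *\<^sub>v z) = z" "Q *\<^sub>v (transpose_mat Q *\<^sub>v z) = z"
  using assms assoc_mult_mat_vec[of "transpose_mat Q" k k Q k z]
    assoc_mult_mat_vec[of Q k k "transpose_mat Q" k z]
  by (auto simp: is_orthogonal_mat_def)

lemma svd_gram_mult_vec: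
  assumes svd: "is_svd B U S V" and B: "B \<in> carrier_mat m k" and z: "z \<in> carrier_vec k"
  shows "B *\<^sub>v (V *\<^sub>v z) = U *\<^sub>v (S *\<^sub>v z)"
    and "transpose_mat B *\<^sub>v (B *\<^sub>v (V *\<^sub>v z)) = V *\<^sub>v ((transpose_mat S * S) *\<^sub>v z)"
proof -
  have oU: "is_orthogonal_mat m U" and oV: "is_orthogonal_mat k V"
    and S: "S \<in> carrier_mat m k" and dec: "B = U * S * transpose_mat V"
    using svd B by (auto simp: is_svd_def)
  have U: "U \<in> carrier_mat m m" and V: "V \<in> carrier_mat k k"
    using oU oV by (auto simp: is_orthogonal_mat_def)
  have "B *\<^sub>v (V *\<^sub>v z) = (U * S) *\<^sub>v (transpose_mat V *\<^sub>v (V *\<^sub>v z))"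
    unfolding dec by (rule assoc_mult_mat_vec[of _ m k _ k]) (use U S V z in auto)
  then show BV: "B *\<^sub>v (V *\<^sub>v z) = U *\<^sub>v (S *\<^sub>v z)"
    using orthogonal_mat_mult_vec(1)[OF oV z] assoc_mult_mat_vec[OF U S z] by simp
  have "transpose_mat B = V * transpose_mat (U * S)"
    unfolding dec using U S V by (subst transpose_mult) auto
  also have "transpose_mat (U * S) = transpose_mat S * transpose_mat U"
    using U S by (rule transpose_mult)
  finally have "transpose_mat B *\<^sub>v t = V *\<^sub>v (transpose_mat S *\<^sub>v (transpose_mat U *\<^sub>v t))"
    if "t \<in> carrier_vec m" for t
    using that U S V by (simp add: assoc_mult_mat_vec[of _ k k _ m] assoc_mult_mat_vec[of _ k m _ m])
  from this[of "U *\<^sub>v (S *\<^sub>v z)"]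
  show "transpose_mat B *\<^sub>v (B *\<^sub>v (V *\<^sub>v z)) = V *\<^sub>v ((transpose_mat S * S) *\<^sub>v z)"
    unfolding BV using U S V z orthogonal_mat_mult_vec(1)[OF oU, of "S *\<^sub>v z"]
    by (simp add: assoc_mult_mat_vec[of _ k m _ k])
qed

text \<open>In the coordinates \<open>z = V\<^sup>T w\<close> the hypothesis says that \<open>\<Sum>i. (S\<^sub>i\<^sub>i\<^sup>2 - S\<^sub>n\<^sub>n\<^sup>2) z\<^sub>i\<^sup>2 \<le> 0\<close>.  All terms are
  nonnegative because the singular values are sorted, so each vanishes: \<open>z\<close> lives on the
  coordinates whose singular value is \<open>S\<^sub>n\<^sub>n\<close>.\<close>

lemma small_quotient_imp_eigenvector:
  assumes svd: "is_svd B U S V" and B: "B \<in> carrier_mat m (Suc n)" and nm: "Suc n \<le> m"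
    and w: "w \<in> carrier_vec (Suc n)"
    and le: "(B *\<^sub>v w) \<bullet> (B *\<^sub>v w) \<le> (S $$ (n, n))\<^sup>2 * (w \<bullet> w)"
  shows "transpose_mat B *\<^sub>v (B *\<^sub>v w) = (S $$ (n, n))\<^sup>2 \<cdot>\<^sub>v w"
proof -
  have oV: "is_orthogonal_mat (Suc n) V" and S: "S \<in> carrier_mat m (Suc n)" "diagonal_mat S"
    and nonneg: "\<And>i. i < Suc n \<Longrightarrow> 0 \<le> S $$ (i, i)"
    and sorted: "\<And>i. i < Suc n \<Longrightarrow> S $$ (n, n) \<le> S $$ (i, i)"
    using svd B nm by (auto simp: is_svd_def)
  have V: "V \<in> carrier_mat (Suc n) (Suc n)" using oV by (auto simp: is_orthogonal_mat_def)
  let ?s = "S $$ (n, n)" and ?G = "transpose_mat S * S"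
  have G: "?G \<in> carrier_mat (Suc n) (Suc n)" using S by auto
  define z where "z = transpose_mat V *\<^sub>v w"
  have z: "z \<in> carrier_vec (Suc n)" using V w by (simp add: z_def)
  have wz: "w = V *\<^sub>v z" using orthogonal_mat_mult_vec(2)[OF oV w] by (simp add: z_def)
  have iso: "(V *\<^sub>v y) \<bullet> (V *\<^sub>v t) = y \<bullet> t"
    if "y \<in> carrier_vec (Suc n)" "t \<in> carrier_vec (Suc n)" for y t
    using transpose_vec_mult_scalar[OF V that(2), of "V *\<^sub>v y"] that V
      orthogonal_mat_mult_vec(1)[OF oV that(1)] by simp
  have gram: "transpose_mat B *\<^sub>v (B *\<^sub>v w) = V *\<^sub>v (?G *\<^sub>v z)"
    using svd_gram_mult_vec(2)[OF svd B z] wz by simp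
  have "(B *\<^sub>v w) \<bullet> (B *\<^sub>v w) = z \<bullet> (?G *\<^sub>v z)"
    unfolding square_norm_mult_vec[OF B w] gram using iso[of z "?G *\<^sub>v z"] z G wz by simp
  also have "\<dots> = (\<Sum>i<Suc n. (S $$ (i, i))\<^sup>2 * (z $ i)\<^sup>2)"
  proof -
    have "dim_vec (?G *\<^sub>v z) = Suc n" using S(1) by simp
    then have "z \<bullet> (?G *\<^sub>v z) = (\<Sum>i<Suc n. z $ i * (?G *\<^sub>v z) $ i)"
      by (simp only: scalar_prod_def lessThan_atLeast0)
    also have "\<dots> = (\<Sum>i<Suc n. (S $$ (i, i))\<^sup>2 * (z $ i)\<^sup>2)"
    proof (rule sum.cong)
      fix i assume "i \<in> {..<Suc n}"
      then have i: "i < Suc n" by simp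
      show "z $ i * (?G *\<^sub>v z) $ i = (S $$ (i, i))\<^sup>2 * (z $ i)\<^sup>2"
        unfolding gram_diag_mult_vec[OF S nm z i] by (simp only: power2_eq_square mult_ac)
    qed simp
    finally show ?thesis .
  qed
  finally have e1: "(B *\<^sub>v w) \<bullet> (B *\<^sub>v w) = (\<Sum>i<Suc n. (S $$ (i, i))\<^sup>2 * (z $ i)\<^sup>2)" .
  have e2: "w \<bullet> w = (\<Sum>i<Suc n. (z $ i)\<^sup>2)"
    using iso[OF z z] wz z square_norm_eq_sum[of z] by simp
  let ?f = "\<lambda>i. ((S $$ (i, i))\<^sup>2 - ?s\<^sup>2) * (z $ i)\<^sup>2"
  have pos: "0 \<le> ?f i" if "i \<in> {..<Suc n}" for i
    using that nonneg[of n] sorted[of i] by (auto intro!: mult_nonneg_nonneg power_mono)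
  have "sum ?f {..<Suc n} = (B *\<^sub>v w) \<bullet> (B *\<^sub>v w) - ?s\<^sup>2 * (w \<bullet> w)"
    unfolding e1 e2 by (simp only: left_diff_distrib sum_subtractf sum_distrib_left)
  then have "sum ?f {..<Suc n} = 0"
    using le sum_nonneg[of "{..<Suc n}" ?f, OF pos] by linarith
  then have zero: "?f i = 0" if "i < Suc n" for i
    using sum_nonneg_eq_0_iff[of "{..<Suc n}" ?f] pos that by blast
  have "?G *\<^sub>v z = ?s\<^sup>2 \<cdot>\<^sub>v z"
  proof (rule eq_vecI)
    fix i assume "i < dim_vec (?s\<^sup>2 \<cdot>\<^sub>v z)"
    then have i: "i < Suc n" using z by simp
    show "(?G *\<^sub>v z) $ i = (?s\<^sup>2 \<cdot>\<^sub>v z) $ i"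
      using gram_diag_mult_vec[OF S nm z i] zero[OF i] z i by auto
  qed (use G z in auto)
  then show ?thesis unfolding gram using V z wz by (simp add: mult_mat_vec)
qed

lemma svd_last_vectors:
  assumes svd: "is_svd B U S V" and B: "B \<in> carrier_mat m (Suc n)" and nm: "Suc n \<le> m"
  shows "B *\<^sub>v col V n = S $$ (n, n) \<cdot>\<^sub>v col U n"
    and "col U n \<bullet> col U n = 1" and "col V n \<bullet> col V n = 1"
proof -
  have U: "U \<in> carrier_mat m m" "transpose_mat U * U = 1\<^sub>m m"
    and V: "V \<in> carrier_mat (Suc n) (Suc n)" "transpose_mat V * V = 1\<^sub>m (Suc n)"
    and S: "S \<in> carrier_mat m (Suc n)" "diagonal_mat S"
    using svd B by (auto simp: is_svd_def is_orthogonal_mat_def)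
  have "(transpose_mat U * U) $$ (n, n) = 1" using U(2) nm by simp
  then show "col U n \<bullet> col U n = 1" using U(1) nm by simp
  have "(transpose_mat V * V) $$ (n, n) = 1" using V(2) by simp
  then show "col V n \<bullet> col V n = 1" using V(1) by simp
  have Vc: "col V n = V *\<^sub>v unit_vec (Suc n) n"
    using V(1) by (intro eq_vecI) auto
  have Uc: "col U n = U *\<^sub>v unit_vec m n"
    using U(1) nm by (intro eq_vecI) auto
  have Se: "S *\<^sub>v unit_vec (Suc n) n = S $$ (n, n) \<cdot>\<^sub>v unit_vec m n"
    using S nm by (intro eq_vecI) (auto simp: diagonal_mat_def)
  show "B *\<^sub>v col V n = S $$ (n, n) \<cdot>\<^sub>v col U n"
    unfolding Vc Uc using svd_gram_mult_vec(1)[OF svd B, of "unit_vec (Suc n) n"] U(1)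
    by (simp add: Se mult_mat_vec)
qed

section \<open>Genericity\<close>

text \<open>Finiteness is what makes the minimum in \<^const>\<open>smallest_singular_value\<close> a lower bound.\<close>

lemma finite_singular_values:
  assumes A: "A \<in> carrier_mat m n"
  shows "finite (singular_values A)"
proof -
  let ?p = "char_poly (transpose_mat A * A)"
  have G: "transpose_mat A * A \<in> carrier_mat n n" using A by auto
  have "?p \<noteq> 0" using degree_monic_char_poly[OF G] by auto
  then have "finite {t. poly ?p t = 0}" by (rule poly_roots_finite)
  moreover have "(\<lambda>s. s\<^sup>2) ` singular_values A \<subseteq> {t. poly ?p t = 0}"
    by (auto simp: singular_values_def eigenvalue_root_char_poly[OF G])
  ultimately have "finite ((\<lambda>s. s\<^sup>2) ` singular_values A)" by (rule rev_finite_subset)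
  moreover have "inj_on (\<lambda>s. s\<^sup>2) (singular_values A)"
    by (auto simp: singular_values_def inj_on_def power2_eq_iff_nonneg)
  ultimately show ?thesis by (rule finite_imageD)
qed

lemma no_gram_eigenvector_below_singular_values:
  assumes A: "A \<in> carrier_mat m n" and s: "0 \<le> s" "s < smallest_singular_value A"
    and y: "y \<in> carrier_vec n" and ev: "transpose_mat A *\<^sub>v (A *\<^sub>v y) = s\<^sup>2 \<cdot>\<^sub>v y"
  shows "y = 0\<^sub>v n"
proof (rule ccontr)
  assume "y \<noteq> 0\<^sub>v n"
  moreover have "(transpose_mat A * A) *\<^sub>v y = s\<^sup>2 \<cdot>\<^sub>v y"
    using ev A y by (simp add: assoc_mult_mat_vec[of _ n m _ n])
  ultimately have "s \<in> singular_values A"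
    using s(1) A y unfolding singular_values_def eigenvalue_def eigenvector_def by auto
  then have "smallest_singular_value A \<le> s"
    unfolding smallest_singular_value_def by (rule Min_le[OF finite_singular_values[OF A]])
  then show False using s(2) by simp
qed

text \<open>The matrix \<open>P\<close> is injective because a kernel vector is an eigenvector of \<open>A\<^sup>T A\<close> for \<open>s\<^sup>2\<close>.  Knowing
  the size of its inverse is enough for the comparison of the two condition matrices, because both are
  linear in that inverse.\<close>

lemma minv_Pmat_carrier:
  assumes A: "A \<in> carrier_mat m n" and s: "0 \<le> s" "s < smallest_singular_value A"
  shows "minv (Pmat A s) \<in> carrier_mat n n"
proof -
  let ?P = "Pmat A s"
  have P: "?P \<in> carrier_mat n n" using A by (auto simp: Pmat_def)
  have "y = 0\<^sub>v n" if y: "y \<in> carrier_vec n" and Py: "?P *\<^sub>v y = 0\<^sub>v n" for y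
  proof (rule no_gram_eigenvector_below_singular_values[OF A s y])
    have "?P *\<^sub>v y = (transpose_mat A * A) *\<^sub>v y - (s\<^sup>2 \<cdot>\<^sub>m 1\<^sub>m n) *\<^sub>v y"
      unfolding Pmat_def using A y by (simp add: minus_mult_distrib_mat_vec[of _ n n])
    moreover have "(s\<^sup>2 \<cdot>\<^sub>m 1\<^sub>m n) *\<^sub>v y = s\<^sup>2 \<cdot>\<^sub>v y"
      using y by (intro eq_vecI) auto
    moreover have "(transpose_mat A * A) *\<^sub>v y = transpose_mat A *\<^sub>v (A *\<^sub>v y)"
      using A y by (simp add: assoc_mult_mat_vec[of _ n m _ n])
    ultimately have d: "transpose_mat A *\<^sub>v (A *\<^sub>v y) - s\<^sup>2 \<cdot>\<^sub>v y = 0\<^sub>v n" using Py by simp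
    show "transpose_mat A *\<^sub>v (A *\<^sub>v y) = s\<^sup>2 \<cdot>\<^sub>v y"
    proof (rule eq_vecI)
      fix i assume "i < dim_vec (s\<^sup>2 \<cdot>\<^sub>v y)"
      then have i: "i < n" using y by simp
      have "(transpose_mat A *\<^sub>v (A *\<^sub>v y) - s\<^sup>2 \<cdot>\<^sub>v y) $ i = 0" using d i by simp
      then show "(transpose_mat A *\<^sub>v (A *\<^sub>v y)) $ i = (s\<^sup>2 \<cdot>\<^sub>v y) $ i" using y i by simp
    qed (use A y in auto)
  qed
  then have "det ?P \<noteq> 0" using det_0_iff_vec_prod_zero_field[OF P] by blast
  then have "?P \<in> Units (ring_mat TYPE(real) n ())" by (rule det_non_zero_imp_unit[OF P])
  then obtain Q where "mat_inverse ?P = Some Q"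
    using mat_inverse(1)[OF P, of "()"] by (cases "mat_inverse ?P") auto
  then show ?thesis using mat_inverse(2)[OF P] by (simp add: minv_def)
qed

text \<open>For \<open>w = (y; 0)\<close> the first \<open>n\<close> rows of the eigenvector equation read \<open>A\<^sup>T A y = s\<^sup>2 y\<close>.  Consequently
  two eigenvectors for \<open>s\<^sup>2\<close> are equal as soon as their last entries are.\<close>

lemma eigenvector_last_zero:
  assumes A: "A \<in> carrier_mat m n" and b: "b \<in> carrier_vec m"
    and s: "0 \<le> s" "s < smallest_singular_value A"
    and w: "w \<in> carrier_vec (Suc n)" "w $ n = 0"
    and ev: "transpose_mat (aug A b) *\<^sub>v (aug A b *\<^sub>v w) = s\<^sup>2 \<cdot>\<^sub>v w"
  shows "w = 0\<^sub>v (Suc n)"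
proof -
  have "aug A b *\<^sub>v w = A *\<^sub>v vec_first w n"
    unfolding aug_mult_vec[OF A b w(1)] w(2) using A b by (intro eq_vecI) auto
  then have "transpose_mat A *\<^sub>v (A *\<^sub>v vec_first w n) = vec_first (s\<^sup>2 \<cdot>\<^sub>v w) n"
    using vec_first_aug_transpose_mult[OF A b, of "A *\<^sub>v vec_first w n"] A ev by simp
  also have "\<dots> = s\<^sup>2 \<cdot>\<^sub>v vec_first w n"
    using w(1) by (intro eq_vecI) (auto simp: vec_first_def)
  finally have "vec_first w n = 0\<^sub>v n"
    by (rule no_gram_eigenvector_below_singular_values[OF A s vec_first_carrier])
  then have "\<forall>i<n. w $ i = 0"
    by (auto simp: vec_first_def vec_eq_iff)
  then show ?thesis using w by (intro eq_vecI) (auto simp: less_Suc_eq)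
qed

section \<open>The solution of the total least squares problem\<close>

text \<open>Cauchy-Schwarz, applied to each row.\<close>

lemma mult_vec_le_frob_norm:
  assumes E: "E \<in> carrier_mat m k" and z: "z \<in> carrier_vec k"
  shows "(E *\<^sub>v z) \<bullet> (E *\<^sub>v z) \<le> (frob_norm E)\<^sup>2 * (z \<bullet> z)"
proof -
  have row: "((E *\<^sub>v z) $ i)\<^sup>2 \<le> (\<Sum>j<k. (E $$ (i, j))\<^sup>2) * (z \<bullet> z)" if i: "i < m" for i
  proof -
    have "\<bar>(E *\<^sub>v z) $ i\<bar> = \<bar>\<Sum>j<k. E $$ (i, j) * z $ j\<bar>"
      using E z i by (simp add: scalar_prod_def lessThan_atLeast0)
    also have "\<dots> \<le> (\<Sum>j<k. \<bar>E $$ (i, j)\<bar> * \<bar>z $ j\<bar>)"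
      using sum_abs[of "\<lambda>j. E $$ (i, j) * z $ j" "{..<k}"] by (simp add: abs_mult)
    also have "\<dots> \<le> L2_set (\<lambda>j. E $$ (i, j)) {..<k} * L2_set (\<lambda>j. z $ j) {..<k}"
      by (rule L2_set_mult_ineq)
    finally have "\<bar>(E *\<^sub>v z) $ i\<bar>\<^sup>2 \<le> (L2_set (\<lambda>j. E $$ (i, j)) {..<k} * L2_set (\<lambda>j. z $ j) {..<k})\<^sup>2"
      by (rule power_mono) simp
    then show ?thesis
      using z by (simp add: L2_set_def power_mult_distrib sum_nonneg square_norm_eq_sum)
  qed
  have "(E *\<^sub>v z) \<bullet> (E *\<^sub>v z) \<le> (\<Sum>i<m. (\<Sum>j<k. (E $$ (i, j))\<^sup>2) * (z \<bullet> z))"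
    using E row by (auto simp: square_norm_eq_sum[of "E *\<^sub>v z"] intro!: sum_mono)
  also have "\<dots> = (frob_norm E)\<^sup>2 * (z \<bullet> z)"
    using E by (simp add: frob_norm_def sum_nonneg sum_distrib_right)
  finally show ?thesis .
qed

text \<open>The witness is \<open>[A', b'] = B - s u v\<^sup>T\<close>.  It annihilates \<open>v\<close>, and since the last entry of \<open>v\<close> is nonzero,
  \<open>v\<close> can be rescaled to the form \<open>(y; -1)\<close>, which exhibits \<open>b' = A' y\<close>.\<close>

lemma rank_one_correction:
  assumes A: "A \<in> carrier_mat m n" and b: "b \<in> carrier_vec m" and s: "0 \<le> s"
    and u: "u \<in> carrier_vec m" "u \<bullet> u = 1"
    and v: "v \<in> carrier_vec (Suc n)" "v \<bullet> v = 1" "v $ n \<noteq> 0"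
    and sv: "aug A b *\<^sub>v v = s \<cdot>\<^sub>v u"
  shows "\<exists>A' b'. tls_feasible m n A' b' \<and> frob_norm (aug A b - aug A' b') = s"
proof -
  define A' where "A' = mat m n (\<lambda>(i, j). A $$ (i, j) - s * u $ i * v $ j)"
  define b' where "b' = vec m (\<lambda>i. b $ i - s * u $ i * v $ n)"
  have A': "A' \<in> carrier_mat m n" and b': "b' \<in> carrier_vec m"
    by (auto simp: A'_def b'_def)
  have vv: "(\<Sum>j<Suc n. (v $ j)\<^sup>2) = 1" and uu: "(\<Sum>i<m. (u $ i)\<^sup>2) = 1"
    using u v square_norm_eq_sum[of v] square_norm_eq_sum[of u] by auto
  have ent: "(aug A b - aug A' b') $$ (i, j) = s * u $ i * v $ j" if "i < m" "j < Suc n" for i j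
    using that aug_index[OF A b that] aug_index[OF A' b' that] aug_carrier[OF A b] aug_carrier[OF A' b']
    by (auto simp: A'_def b'_def less_Suc_eq)
  have "frob_norm (aug A b - aug A' b') = sqrt (\<Sum>i<m. \<Sum>j<Suc n. (s * u $ i * v $ j)\<^sup>2)"
    using aug_carrier[OF A b] aug_carrier[OF A' b'] ent
    unfolding frob_norm_def by (intro arg_cong[where f = sqrt] sum.cong) auto
  also have "(\<Sum>i<m. \<Sum>j<Suc n. (s * u $ i * v $ j)\<^sup>2)
      = s\<^sup>2 * ((\<Sum>i<m. (u $ i)\<^sup>2) * (\<Sum>j<Suc n. (v $ j)\<^sup>2))"
    unfolding power_mult_distrib sum_product by (simp only: sum_distrib_left mult.assoc)
  finally have frob: "frob_norm (aug A b - aug A' b') = s" using s vv uu by simp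
  let ?y = "(- 1 / v $ n) \<cdot>\<^sub>v vec_first v n"
  have "A' *\<^sub>v ?y = b'"
  proof (rule eq_vecI)
    fix i assume "i < dim_vec b'"
    then have i: "i < m" by (simp add: b'_def)
    have "(aug A b *\<^sub>v v) $ i = (\<Sum>j<n. A $$ (i, j) * v $ j) + b $ i * v $ n"
      unfolding aug_mult_vec[OF A b v(1)] using A b i
      by (simp add: scalar_prod_def lessThan_atLeast0 vec_first_def)
    then have Av: "(\<Sum>j<n. A $$ (i, j) * v $ j) = s * u $ i - b $ i * v $ n"
      using sv u i by simp
    have "(\<Sum>j<n. A' $$ (i, j) * v $ j) = (\<Sum>j<n. A $$ (i, j) * v $ j - s * u $ i * (v $ j)\<^sup>2)"
      using i by (intro sum.cong) (auto simp: A'_def algebra_simps power2_eq_square)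
    also have "\<dots> = (s * u $ i - b $ i * v $ n) - s * u $ i * (1 - (v $ n)\<^sup>2)"
      using vv by (simp add: sum_subtractf Av flip: sum_distrib_left)
    also have "\<dots> = - v $ n * b' $ i"
      using i by (simp add: b'_def algebra_simps power2_eq_square)
    finally have *: "(\<Sum>j<n. A' $$ (i, j) * v $ j) = - v $ n * b' $ i" .
    have "(A' *\<^sub>v ?y) $ i = (\<Sum>j<n. A' $$ (i, j) * (- 1 / v $ n * v $ j))"
      using A' i by (simp add: scalar_prod_def lessThan_atLeast0 vec_first_def)
    also have "\<dots> = (- 1 / v $ n) * (\<Sum>j<n. A' $$ (i, j) * v $ j)"
      by (simp only: sum_distrib_left mult.left_commute)
    finally show "(A' *\<^sub>v ?y) $ i = b' $ i" using v(3) * by simp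
  qed (use A' b' in auto)
  moreover have "?y \<in> carrier_vec n" by simp
  ultimately have "tls_feasible m n A' b'" unfolding tls_feasible_def using A' b' by blast
  with frob show ?thesis by blast
qed

text \<open>The closed form of the solution: \<open>(x; -1) = - v / v\<^sub>n\<close>.  The vector \<open>(x; -1)\<close> is an eigenvector of
  \<open>B\<^sup>T B\<close> for the smallest eigenvalue because the optimal correction cannot be larger than the rank-one
  correction, and genericity identifies it with \<open>v\<close> up to scaling.\<close>

lemma tls_solution_singular_vector:
  assumes A: "A \<in> carrier_mat m n" and b: "b \<in> carrier_vec m" and nm: "n < m"
    and svd: "is_svd (aug A b) U S V"
    and generic: "S $$ (n, n) < smallest_singular_value A"
    and tls: "is_tls_solution A b x"
  shows "col V n $ n \<noteq> 0" and "vec_first (col V n) n = (- (col V n $ n)) \<cdot>\<^sub>v x"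
proof -
  let ?B = "aug A b" and ?s = "S $$ (n, n)" and ?v = "col V n" and ?u = "col U n"
  have B: "?B \<in> carrier_mat m (Suc n)" by (rule aug_carrier[OF A b])
  have nm': "Suc n \<le> m" using nm by simp
  have s: "0 \<le> ?s" and U: "U \<in> carrier_mat m m" and V: "V \<in> carrier_mat (Suc n) (Suc n)"
    using svd B nm by (auto simp: is_svd_def is_orthogonal_mat_def)
  have v: "?v \<in> carrier_vec (Suc n)" and u: "?u \<in> carrier_vec m"
    using U V by (auto intro!: carrier_vecI)
  note last = svd_last_vectors[OF svd B nm']
  have evv: "transpose_mat ?B *\<^sub>v (?B *\<^sub>v ?v) = ?s\<^sup>2 \<cdot>\<^sub>v ?v"
    using last u by (intro small_quotient_imp_eigenvector[OF svd B nm' v]) (simp add: power2_eq_square)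
  show vn: "?v $ n \<noteq> 0"
  proof
    assume "?v $ n = 0"
    then have "?v = 0\<^sub>v (Suc n)" by (rule eigenvector_last_zero[OF A b s generic v _ evv])
    then show False using last(3) by simp
  qed
  obtain A' b' where x: "x \<in> carrier_vec n" and feas: "tls_feasible m n A' b'"
    and min: "\<And>A'' b''. tls_feasible m n A'' b'' \<Longrightarrow>
        frob_norm (?B - aug A' b') \<le> frob_norm (?B - aug A'' b'')"
    and sol: "A' *\<^sub>v x = b'"
    using tls A unfolding is_tls_solution_def tls_minimizer_def by auto
  have A': "A' \<in> carrier_mat m n" and b': "b' \<in> carrier_vec m"
    using feas by (auto simp: tls_feasible_def)
  let ?E = "?B - aug A' b'"
  have E: "?E \<in> carrier_mat m (Suc n)" using aug_carrier[OF A' b'] by auto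
  have "frob_norm ?E \<le> ?s"
    using rank_one_correction[OF A b s u last(2) v last(3) vn last(1)] min by metis
  moreover have "0 \<le> frob_norm ?E" by (simp add: frob_norm_def sum_nonneg)
  ultimately have fE: "(frob_norm ?E)\<^sup>2 \<le> ?s\<^sup>2" by (simp add: power_mono)
  define z where "z = vec (Suc n) (\<lambda>j. if j < n then x $ j else - 1)"
  have z: "z \<in> carrier_vec (Suc n)" by (simp add: z_def)
  have zx: "vec_first z n = x" using x by (auto simp: z_def vec_first_def)
  have "aug A' b' *\<^sub>v z = 0\<^sub>v m"
    unfolding aug_mult_vec[OF A' b' z] zx sol using b' by (intro eq_vecI) (auto simp: z_def)
  then have "?E *\<^sub>v z = ?B *\<^sub>v z"
    using B z aug_carrier[OF A' b'] by (simp add: minus_mult_distrib_mat_vec[of _ m "Suc n"])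
  then have "(?B *\<^sub>v z) \<bullet> (?B *\<^sub>v z) \<le> (frob_norm ?E)\<^sup>2 * (z \<bullet> z)"
    using mult_vec_le_frob_norm[OF E z] by simp
  also have "\<dots> \<le> ?s\<^sup>2 * (z \<bullet> z)"
    using fE by (intro mult_right_mono) (simp_all add: square_norm_eq_sum sum_nonneg)
  finally have evz: "transpose_mat ?B *\<^sub>v (?B *\<^sub>v z) = ?s\<^sup>2 \<cdot>\<^sub>v z"
    by (rule small_quotient_imp_eigenvector[OF svd B nm' z])
  \<comment> \<open>The combination of the eigenvectors \<open>v\<close> and \<open>z\<close> whose last entry cancels.\<close>
  let ?w = "?v + ?v $ n \<cdot>\<^sub>v z"
  have w: "?w \<in> carrier_vec (Suc n)" using v z by simp
  have wn: "?w $ n = 0" using v z by (simp add: z_def)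
  have "transpose_mat ?B *\<^sub>v (?B *\<^sub>v ?w) = transpose_mat ?B *\<^sub>v (?B *\<^sub>v ?v)
      + ?v $ n \<cdot>\<^sub>v (transpose_mat ?B *\<^sub>v (?B *\<^sub>v z))"
    using B v z by (simp add: mult_add_distrib_mat_vec[of _ m "Suc n"]
        mult_add_distrib_mat_vec[of _ "Suc n" m] mult_mat_vec[of _ m "Suc n"] mult_mat_vec[of _ "Suc n" m])
  also have "\<dots> = ?s\<^sup>2 \<cdot>\<^sub>v ?w"
    unfolding evv evz using V z by (intro eq_vecI) (auto simp: algebra_simps)
  finally have "?w = 0\<^sub>v (Suc n)"
    by (rule eigenvector_last_zero[OF A b s generic w wn])
  then have w0: "?w $ j = 0" if "j < n" for j using that by simp
  show "vec_first ?v n = (- (?v $ n)) \<cdot>\<^sub>v x"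
  proof (rule eq_vecI)
    fix j assume "j < dim_vec ((- (?v $ n)) \<cdot>\<^sub>v x)"
    then have j: "j < n" using x by simp
    have "?w $ j = ?v $ j + ?v $ n * x $ j" using j v z by (simp add: z_def)
    then show "vec_first ?v n $ j = ((- (?v $ n)) \<cdot>\<^sub>v x) $ j"
      using w0[OF j] j x by (simp add: vec_first_def)
  qed (use x in auto)
qed

section \<open>Equality of the two condition matrices\<close>

lemma hcat_carrier:
  assumes "X \<in> carrier_mat n k" "Y \<in> carrier_mat n l"
  shows "hcat X Y \<in> carrier_mat n (k + l)"
  using assms by (auto simp: hcat_def)

lemma hcat_index:
  assumes "X \<in> carrier_mat n k" "Y \<in> carrier_mat n l" "i < n" "j < k + l"
  shows "hcat X Y $$ (i, j) = (if j < k then X $$ (i, j) else Y $$ (i, j - k))"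
  using assms by (auto simp: hcat_def)

lemma abs_hcat_mult_append:
  assumes X: "X \<in> carrier_mat n k" and Y: "Y \<in> carrier_mat n l"
    and p: "p \<in> carrier_vec k" and q: "q \<in> carrier_vec l"
  shows "abs_mat (hcat X Y) *\<^sub>v (p @\<^sub>v q) = abs_mat X *\<^sub>v p + abs_mat Y *\<^sub>v q"
proof (rule eq_vecI)
  fix i assume "i < dim_vec (abs_mat X *\<^sub>v p + abs_mat Y *\<^sub>v q)"
  then have i: "i < n" using Y by simp
  have "row (abs_mat (hcat X Y)) i = row (abs_mat X) i @\<^sub>v row (abs_mat Y) i"
    using X Y i hcat_carrier[OF X Y] hcat_index[OF X Y i] by (intro eq_vecI) auto
  then show "(abs_mat (hcat X Y) *\<^sub>v (p @\<^sub>v q)) $ i = (abs_mat X *\<^sub>v p + abs_mat Y *\<^sub>v q) $ i"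
    using X Y i p q hcat_carrier[OF X Y] by (simp add: scalar_prod_append[of _ k _ l])
qed (use X Y hcat_carrier[OF X Y] in auto)

lemma vectorize_abs: "abs_vec (vectorize A) = vectorize (abs_mat A)"
proof (rule eq_vecI)
  fix k assume "k < dim_vec (vectorize (abs_mat A))"
  then have k: "k < dim_row A * dim_col A" by (simp add: vectorize_def)
  then have "k div dim_row A < dim_col A" by (simp add: less_mult_imp_div_less mult.commute)
  moreover have "k mod dim_row A < dim_row A" using k by (cases "dim_row A") auto
  ultimately
  show "abs_vec (vectorize A) $ k = vectorize (abs_mat A) $ k"
    using k by (simp add: vectorize_def)
qed (simp add: vectorize_def)

lemma kron_row_left_index:
  assumes "X \<in> carrier_mat p m" "dim_vec y = n" "i < p" "k < n * m"
  shows "kron (row_of y) X $$ (i, k) = y $ (k div m) * X $$ (i, k mod m)"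
  using assms by (auto simp: kron_def less_mult_imp_div_less)

lemma kron_row_right_index:
  assumes "X \<in> carrier_mat p n" "dim_vec y = m" "i < p" "k < n * m"
  shows "kron X (row_of y) $$ (i, k) = X $$ (i, k div m) * y $ (k mod m)"
proof -
  have "0 < m" using assms(4) by (cases m) auto
  then show ?thesis using assms by (auto simp: kron_def)
qed

lemma column_times_row_index:
  assumes "(X :: real mat) \<in> carrier_mat n 1" "Y \<in> carrier_mat 1 k" "i < n" "j < k"
  shows "(X * Y) $$ (i, j) = X $$ (i, 0) * Y $$ (0, j)"
  using assms by (simp add: scalar_prod_def)

text \<open>The inverse \<open>Q\<close> is a common left factor of both condition matrices and stays an opaque matrix of
  known size; the identity is one between the factors to its right.\<close>

context
  fixes A Q :: "real mat" and b x :: "real vec" and m n :: nat and s :: real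
  assumes A: "A \<in> carrier_mat m n" and b: "b \<in> carrier_vec m" and x: "x \<in> carrier_vec n"
    and Q: "Q \<in> carrier_mat n n" and Q_def: "Q = minv (Pmat A s)"
begin

lemma tls_residual_carrier: "tls_residual A b x \<in> carrier_vec m"
  using A b by (auto simp: tls_residual_def intro!: carrier_vecI)

lemma Gmat_carrier: "Gmat A b x \<in> carrier_mat n m"
  using A b x tls_residual_carrier by (auto simp: Gmat_def)

lemma calH_carrier: "calH A b x s \<in> carrier_mat n m"
  using Q Gmat_carrier by (auto simp: calH_def Q_def)

lemma calN_carrier: "calN A b x s \<in> carrier_mat n (n * m)"
  using Q Gmat_carrier A x tls_residual_carrier
  by (auto simp: calN_def Q_def[symmetric] kron_def)

text \<open>The matrices are compared entry by entry.  Column \<open>k = j * m + l\<close> of \<open>calN\<close> belongs to the entry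
  \<open>(l, j)\<close> of \<open>A\<close>, so that \<open>j = k div m\<close> and \<open>l = k mod m\<close>.\<close>

lemma calH_index:
  assumes i: "i < n" and l: "l < m"
  shows "calH A b x s $$ (i, l) =
    (Q * transpose_mat A) $$ (i, l) + 2 / (1 + x \<bullet> x) * (Q *\<^sub>v x) $ i * tls_residual A b x $ l"
proof -
  let ?r = "tls_residual A b x" and ?c = "2 / (1 + x \<bullet> x)"
  have r: "?r \<in> carrier_vec m" by (rule tls_residual_carrier)
  have "calH A b x s $$ (i, l) = (\<Sum>p<n. Q $$ (i, p) * Gmat A b x $$ (p, l))"
    using Q Gmat_carrier i l unfolding calH_def Q_def[symmetric]
    by (simp add: scalar_prod_def lessThan_atLeast0)
  also have "\<dots> = (\<Sum>p<n. Q $$ (i, p) * A $$ (l, p) + ?c * (Q $$ (i, p) * x $ p) * ?r $ l)"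
  proof (rule sum.cong)
    fix p assume "p \<in> {..<n}"
    then have p: "p < n" by simp
    have "Gmat A b x $$ (p, l) = A $$ (l, p) + ?c * (x $ p * ?r $ l)"
      using A x r p l column_times_row_index[of "col_of x" n "row_of ?r" m p l]
      by (simp add: Gmat_def del: index_mult_mat(1))
    then show "Q $$ (i, p) * Gmat A b x $$ (p, l) =
        Q $$ (i, p) * A $$ (l, p) + ?c * (Q $$ (i, p) * x $ p) * ?r $ l"
      by (simp only: algebra_simps)
  qed simp
  also have "\<dots> = (\<Sum>p<n. Q $$ (i, p) * A $$ (l, p)) + ?c * (\<Sum>p<n. Q $$ (i, p) * x $ p) * ?r $ l"
    by (simp only: sum.distrib sum_distrib_left sum_distrib_right)
  finally show ?thesis
    using Q A x i l by (simp add: scalar_prod_def lessThan_atLeast0)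
qed

lemma calN_index:
  assumes i: "i < n" and k: "k < n * m"
  shows "calN A b x s $$ (i, k) =
    Q $$ (i, k div m) * tls_residual A b x $ (k mod m) - x $ (k div m) * calH A b x s $$ (i, k mod m)"
proof -
  let ?r = "tls_residual A b x" and ?G = "Gmat A b x"
  let ?j = "k div m" and ?l = "k mod m"
  let ?K = "kron (- row_of x) ?G + kron (1\<^sub>m n) (row_of ?r)"
  have r: "dim_vec ?r = m" using tls_residual_carrier by simp
  have j: "?j < n" using k by (simp add: less_mult_imp_div_less)
  have l: "?l < m" using k by (cases m) auto
  have K1: "kron (- row_of x) ?G \<in> carrier_mat n (n * m)"
    using Gmat_carrier x by (auto simp: kron_def)
  have K2: "kron (1\<^sub>m n) (row_of ?r) \<in> carrier_mat n (n * m)"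
    using r by (auto simp: kron_def)
  have K: "?K $$ (p, k) = - (x $ ?j) * ?G $$ (p, ?l) + (if p = ?j then ?r $ ?l else 0)"
    if p: "p < n" for p
    using kron_row_left_index[OF Gmat_carrier, of "- x" n p k]
      kron_row_right_index[OF one_carrier_mat r p k] x p k j K1 K2
    by (simp add: mat_of_row_uminus)
  have "calN A b x s $$ (i, k) = (\<Sum>p<n. Q $$ (i, p) * ?K $$ (p, k))"
    using Q K1 K2 A i k unfolding calN_def Q_def[symmetric]
    by (simp add: scalar_prod_def lessThan_atLeast0)
  also have "\<dots> = (\<Sum>p<n. (if p = ?j then Q $$ (i, ?j) * ?r $ ?l else 0)
      - x $ ?j * (Q $$ (i, p) * ?G $$ (p, ?l)))"
  proof (rule sum.cong)
    fix p assume "p \<in> {..<n}"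
    then have p: "p < n" by simp
    show "Q $$ (i, p) * ?K $$ (p, k) = (if p = ?j then Q $$ (i, ?j) * ?r $ ?l else 0)
        - x $ ?j * (Q $$ (i, p) * ?G $$ (p, ?l))"
      unfolding K[OF p] by (simp add: algebra_simps)
  qed simp
  also have "\<dots> = Q $$ (i, ?j) * ?r $ ?l - x $ ?j * (\<Sum>p<n. Q $$ (i, p) * ?G $$ (p, ?l))"
    using j by (simp add: sum_subtractf sum_distrib_left)
  also have "(\<Sum>p<n. Q $$ (i, p) * ?G $$ (p, ?l)) = calH A b x s $$ (i, ?l)"
    using Q Gmat_carrier i l unfolding calH_def Q_def[symmetric]
    by (simp add: scalar_prod_def lessThan_atLeast0)
  finally show ?thesis .
qed

text \<open>With \<open>v = - c (x; -1)\<close>, \<open>s u = c r\<close> and \<open>2 c\<^sup>2 = 2 / (1 + x \<bullet> x)\<close>, the entries of \<open>N\<close> are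
  \<open>- 2 c\<^sup>2 (Q x)\<^sub>i x\<^sub>j r\<^sub>l\<close> in the columns of \<open>A\<close> and \<open>2 c\<^sup>2 (Q x)\<^sub>i r\<^sub>l\<close> in those of \<open>b\<close>.  In both blocks this is
  the contribution of the rank-one term of \<^const>\<open>Gmat\<close>.\<close>

lemma Mmat_Nmat_eq_hcat:
  assumes u: "u \<in> carrier_vec m" and v: "v \<in> carrier_vec (Suc n)" "v \<bullet> v = 1"
    and vx: "vec_first v n = (- (v $ n)) \<cdot>\<^sub>v x"
    and sv: "aug A b *\<^sub>v v = s \<cdot>\<^sub>v u"
  shows "Mmat A b x s + Nmat A x s u v = hcat (calN A b x s) (calH A b x s)"
proof -
  let ?r = "tls_residual A b x" and ?c = "v $ n"
  have r: "?r \<in> carrier_vec m" by (rule tls_residual_carrier)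
  have v_index: "v $ j = - ?c * x $ j" if "j < n" for j
    using arg_cong[OF vx, of "\<lambda>t. t $ j"] that x by (simp add: vec_first_def)
  have "(\<Sum>j<n. (v $ j)\<^sup>2) = (\<Sum>j<n. ?c\<^sup>2 * (x $ j)\<^sup>2)"
    by (intro sum.cong) (auto simp: v_index power_mult_distrib)
  then have "1 = ?c\<^sup>2 * (x \<bullet> x) + ?c\<^sup>2"
    using v x square_norm_eq_sum[of v] square_norm_eq_sum[of x] by (simp add: sum_distrib_left)
  then have cc1: "?c\<^sup>2 * (1 + x \<bullet> x) = 1" by (simp add: algebra_simps)
  then have "1 + x \<bullet> x \<noteq> 0" by auto
  then have cc: "2 / (1 + x \<bullet> x) = 2 * ?c\<^sup>2" using cc1 by (simp add: field_simps)
  have Bv: "aug A b *\<^sub>v v = (- ?c) \<cdot>\<^sub>v (A *\<^sub>v x) + ?c \<cdot>\<^sub>v b"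
    unfolding aug_mult_vec[OF A b v(1)] vx using A x by (simp add: mult_mat_vec)
  have su: "s * u $ l = ?c * ?r $ l" if "l < m" for l
  proof -
    have "(s \<cdot>\<^sub>v u) $ l = ((- ?c) \<cdot>\<^sub>v (A *\<^sub>v x) + ?c \<cdot>\<^sub>v b) $ l" using sv Bv by simp
    then show ?thesis using that A b u by (simp add: tls_residual_def algebra_simps)
  qed
  define M1 where "M1 = kron Q (row_of b) - kron (row_of x) (Q * transpose_mat A)
      - kron Q (row_of (A *\<^sub>v x))"
  have QA: "Q * transpose_mat A \<in> carrier_mat n m" using Q A by auto
  have M1: "M1 \<in> carrier_mat n (n * m)"
    using Q A b x by (auto simp: M1_def kron_def)
  have M: "Mmat A b x s = hcat M1 (Q * transpose_mat A)"
    by (simp add: Mmat_def M1_def Q_def Let_def)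
  have kc: "kron (row_of v) (row_of u) \<in> carrier_mat 1 (n * m + m)"
    using u v by (auto simp: kron_def)
  have Qx: "Q * col_of x \<in> carrier_mat n 1" using Q x by (intro carrier_matI) auto
  have N: "Nmat A x s u v \<in> carrier_mat n (n * m + m)"
    using Qx kc by (auto simp: Nmat_def Q_def)
  have M1_index: "M1 $$ (i, k) = Q $$ (i, k div m) * ?r $ (k mod m)
      - x $ (k div m) * (Q * transpose_mat A) $$ (i, k mod m)" if i: "i < n" and k: "k < n * m" for i k
  proof -
    have l: "k mod m < m" using k by (cases m) auto
    have c: "kron Q (row_of b) \<in> carrier_mat n (n * m)"
      "kron (row_of x) (Q * transpose_mat A) \<in> carrier_mat n (n * m)"
      "kron Q (row_of (A *\<^sub>v x)) \<in> carrier_mat n (n * m)"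
      using Q A b x by (auto simp: kron_def)
    have "M1 $$ (i, k) = Q $$ (i, k div m) * b $ (k mod m)
      - x $ (k div m) * (Q * transpose_mat A) $$ (i, k mod m)
      - Q $$ (i, k div m) * (A *\<^sub>v x) $ (k mod m)"
      using c i k kron_row_right_index[OF Q, of b m i k] kron_row_left_index[OF QA, of x n i k]
        kron_row_right_index[OF Q, of "A *\<^sub>v x" m i k] A b x
      by (simp add: M1_def del: index_mult_mat(1) index_mult_mat_vec)
    moreover have rl: "?r $ (k mod m) = b $ (k mod m) - (A *\<^sub>v x) $ (k mod m)"
      using A l by (simp add: tls_residual_def)
    ultimately show ?thesis unfolding rl by (simp only: algebra_simps)
  qed
  have N_index: "Nmat A x s u v $$ (i, k) =
      2 * ?c * (Q *\<^sub>v x) $ i * v $ (k div m) * ?r $ (k mod m)" if i: "i < n" and k: "k < n * m + m" for i k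
  proof -
    have l: "k mod m < m" using k by (cases m) auto
    have k': "k < Suc n * m" using k by simp
    have "(Q * col_of x * kron (row_of v) (row_of u)) $$ (i, k)
        = (Q * col_of x) $$ (i, 0) * kron (row_of v) (row_of u) $$ (0, k)"
      by (rule column_times_row_index[OF Qx kc i k])
    also have "(Q * col_of x) $$ (i, 0) = (Q *\<^sub>v x) $ i"
      using Q x i by (simp add: scalar_prod_def)
    also have "kron (row_of v) (row_of u) $$ (0, k) = v $ (k div m) * u $ (k mod m)"
      using kron_row_left_index[of "row_of u" 1 m v "Suc n" 0 k] u v k' l by simp
    finally have "Nmat A x s u v $$ (i, k) =
        2 * s * ((Q *\<^sub>v x) $ i * (v $ (k div m) * u $ (k mod m)))"
      using Q kc i k by (simp add: Nmat_def Q_def[symmetric] del: index_mult_mat(1) index_mult_mat_vec)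
    also have "\<dots> = 2 * (Q *\<^sub>v x) $ i * v $ (k div m) * (s * u $ (k mod m))"
      by (simp only: mult_ac)
    finally show ?thesis unfolding su[OF l] by (simp only: mult_ac)
  qed
  show ?thesis
  proof (rule eq_matI)
    fix i k assume "i < dim_row (hcat (calN A b x s) (calH A b x s))"
      "k < dim_col (hcat (calN A b x s) (calH A b x s))"
    then have i: "i < n" and k: "k < n * m + m"
      using hcat_carrier[OF calN_carrier calH_carrier] by auto
    have L: "(Mmat A b x s + Nmat A x s u v) $$ (i, k) =
        (if k < n * m then M1 $$ (i, k) else (Q * transpose_mat A) $$ (i, k - n * m))
        + 2 * ?c * (Q *\<^sub>v x) $ i * v $ (k div m) * ?r $ (k mod m)"
      using N N_index[OF i k] hcat_index[OF M1 QA i k] i k unfolding M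
      by (simp del: index_mult_mat(1) index_mult_mat_vec)
    have R: "hcat (calN A b x s) (calH A b x s) $$ (i, k) =
        (if k < n * m then calN A b x s $$ (i, k) else calH A b x s $$ (i, k - n * m))"
      by (rule hcat_index[OF calN_carrier calH_carrier i k])
    show "(Mmat A b x s + Nmat A x s u v) $$ (i, k) = hcat (calN A b x s) (calH A b x s) $$ (i, k)"
    proof (cases "k < n * m")
      case True
      then have j: "k div m < n" by (simp add: less_mult_imp_div_less)
      have l: "k mod m < m" using True by (cases m) auto
      show ?thesis
        unfolding L R if_P[OF True] M1_index[OF i True] calN_index[OF i True] calH_index[OF i l] cc v_index[OF j]
        by (simp only: algebra_simps power2_eq_square)
    next
      case False
      \<comment> \<open>The last \<open>m\<close> columns, where \<open>k div m = n\<close> selects the last entry of \<open>v\<close>.\<close>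
      define l where "l = k - n * m"
      have l: "l < m" and kl: "k = l + n * m" using k False by (auto simp: l_def)
      have dm: "k div m = n" "k mod m = l" using l unfolding kl by auto
      show ?thesis
        unfolding L R if_not_P[OF False] dm l_def[symmetric] calH_index[OF i l] cc
        by (simp only: algebra_simps power2_eq_square)
    qed
  qed (use M1 QA N hcat_carrier[OF M1 QA] hcat_carrier[OF calN_carrier calH_carrier] M in auto)
qed

lemma abs_Mmat_Nmat_mult:
  assumes u: "u \<in> carrier_vec m" and v: "v \<in> carrier_vec (Suc n)" "v \<bullet> v = 1"
    and vx: "vec_first v n = (- (v $ n)) \<cdot>\<^sub>v x"
    and sv: "aug A b *\<^sub>v v = s \<cdot>\<^sub>v u"
  shows "abs_mat (Mmat A b x s + Nmat A x s u v) *\<^sub>v (abs_vec (vectorize A) @\<^sub>v abs_vec b) =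
    abs_mat (calN A b x s) *\<^sub>v vectorize (abs_mat A) + abs_mat (calH A b x s) *\<^sub>v abs_vec b"
  unfolding Mmat_Nmat_eq_hcat[OF u v vx sv] vectorize_abs
  by (rule abs_hcat_mult_append[OF calN_carrier calH_carrier])
    (use A b in \<open>auto simp: vectorize_def mult.commute\<close>)

end

theorem theorem3p2:
  fixes A U S V :: "real mat" and b x :: "real vec" and m n :: nat
  assumes "0 < n" and "n < m"
    and "A \<in> carrier_mat m n" and "b \<in> carrier_vec m"
    and "is_svd (aug A b) U S V"
    and "smallest_singular_value A > S $$ (n, n)"
    and "is_tls_solution A b x"
  shows
    "(x \<noteq> 0\<^sub>v n \<longrightarrow>
       kappa_rel_inf (1\<^sub>m n) A b x (S $$ (n, n)) =
         inf_norm (abs_mat (calN A b x (S $$ (n, n))) *\<^sub>v vectorize (abs_mat A) +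
                   abs_mat (calH A b x (S $$ (n, n))) *\<^sub>v abs_vec b) / inf_norm x \<and>
       inf_norm (abs_mat (calN A b x (S $$ (n, n))) *\<^sub>v vectorize (abs_mat A) +
                 abs_mat (calH A b x (S $$ (n, n))) *\<^sub>v abs_vec b) / inf_norm x =
         m_cond A b x (S $$ (n, n)) (col U n) (col V n)) \<and>
     kappa_c (1\<^sub>m n) A b x (S $$ (n, n)) =
       inf_norm (pinv (diag_of x) *\<^sub>v
         (abs_mat (calN A b x (S $$ (n, n))) *\<^sub>v vectorize (abs_mat A) +
          abs_mat (calH A b x (S $$ (n, n))) *\<^sub>v abs_vec b)) \<and>
     inf_norm (pinv (diag_of x) *\<^sub>v
         (abs_mat (calN A b x (S $$ (n, n))) *\<^sub>v vectorize (abs_mat A) +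
          abs_mat (calH A b x (S $$ (n, n))) *\<^sub>v abs_vec b)) =
       c_cond A b x (S $$ (n, n)) (col U n) (col V n)"
proof -
  let ?s = "S $$ (n, n)"
  have nm: "n < m" and A: "A \<in> carrier_mat m n" and b: "b \<in> carrier_vec m"
    and svd: "is_svd (aug A b) U S V" and generic: "?s < smallest_singular_value A"
    and tls: "is_tls_solution A b x"
    by (fact assms)+
  have B: "aug A b \<in> carrier_mat m (Suc n)" by (rule aug_carrier[OF A b])
  have s: "0 \<le> ?s" and u: "col U n \<in> carrier_vec m" and v: "col V n \<in> carrier_vec (Suc n)"
    using svd B nm by (auto simp: is_svd_def is_orthogonal_mat_def intro!: carrier_vecI)
  have x: "x \<in> carrier_vec n" using tls A by (auto simp: is_tls_solution_def)
  have Q: "minv (Pmat A ?s) \<in> carrier_mat n n" by (rule minv_Pmat_carrier[OF A s generic])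
  note last = svd_last_vectors[OF svd B Suc_leI[OF nm]]
  note key = abs_Mmat_Nmat_mult[OF A b x Q refl u v last(3)
      tls_solution_singular_vector(2)[OF A b nm svd generic tls] last(1)]
  have one: "1\<^sub>m n * calN A b x ?s = calN A b x ?s" "1\<^sub>m n * calH A b x ?s = calH A b x ?s"
    "1\<^sub>m n *\<^sub>v x = x"
    using calN_carrier[OF A b x Q refl] calH_carrier[OF A b x Q refl] x by auto
  show ?thesis
    unfolding kappa_rel_inf_def kappa_c_def m_cond_def c_cond_def one key by simp
qed

end
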